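(* Let $X$ be a poset and $\mathbb{Z}_2$ the field with two elements. The unital linear invertibility preservers of $FI(X,\mathbb{Z}_2)$ are exactly the maps $\varphi:FI(X,\mathbb{Z}_2)\to FI(X,\mathbb{Z}_2)$ of the form $$\varphi(\alpha)=e_{\lambda(L_1(\alpha))}+\psi(\alpha),$$ where $\lambda$ is an endomorphism of the abelian group $(\mathcal{P}(X),\triangle)$ with $\lambda(X)=X$ and $\psi:FI(X,\mathbb{Z}_2)\to J(FI(X,\mathbb{Z}_2))$ is a linear map with $\psi(\delta)=0$.
   Context: The finitary incidence algebra $FI(X,K)$ of a poset $(X,\le)$ over a field $K$ is the $K$-space of formal sums $\alpha=\sum_{x\le y}\alpha_{xy}e_{xy}$ ($x,y\in X$, $\alpha_{xy}\in K$, $e_{xy}$ symbols) such that for all $x<y$ the set of pairs $(u,v)$ with $x\le u<v\le y$ and $\alpha_{uv}\neq 0$ is finite. The product is $\alpha\beta=\sum_{x\le y}\big(\sum_{x\le z\le y}\alpha_{xz}\beta_{zy}\big)e_{xy}$; it is a unital associative algebra with identity $\delta=\sum_{x\in X}e_{xx}$. For $A\subseteq X$, $e_A=\sum_{x\in A}e_{xx}$. Put $J(FI(X,K))=\{\alpha\in FI(X,K)\mid \alpha_{xx}=0\ \forall x\in X\}$ (this is the Jacobson radical), and $L_1(\alpha)=\{x\in X\mid \alpha_{xx}=1\}$. A map $\varphi:A\to A$ on a unital associative algebra $A$ is an invertibility preserver of $A$ if $\varphi(U(A))\subseteq U(A)$, where $U(A)$ is the group of units; it is unital if $\varphi(1_A)=1_A$.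 $\mathcal{P}(X)$ is the set of all subsets of $X$, and $A\triangle B=(A\setminus B)\cup(B\setminus A)$ is the symmetric difference, under which $\mathcal{P}(X)$ is an abelian group. *)

theory Defs
  imports "HOL-Algebra.Module" "HOL-Library.Z2"
begin

text \<open>
  A poset is a carrier set \<open>X\<close> with a relation \<open>r\<close> satisfying \<^term>\<open>partial_order_on X r\<close>;
  \<open>(x, y) \<in> r\<close> means \<open>x \<le> y\<close>. A formal sum is represented by its coefficient function
  \<open>\<alpha> x y\<close>, which is required to vanish whenever \<open>x \<le> y\<close> fails, so that equality of formal
  sums is equality of functions.
\<close>

definition fi_carrier :: "'a set \<Rightarrow> 'a rel \<Rightarrow> ('a \<Rightarrow> 'a \<Rightarrow> 'k::field) set" where
  "fi_carrier X r =
    {\<alpha>. (\<forall>x y. (x, y) \<notin> r \<longrightarrow> \<alpha> x y = 0) \<and>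
        (\<forall>x y. (x, y) \<in> r \<and> x \<noteq> y \<longrightarrow>
          finite {(u, v). (x, u) \<in> r \<and> (u, v) \<in> r \<and> u \<noteq> v \<and> (v, y) \<in> r \<and> \<alpha> u v \<noteq> 0})}"

text \<open>
  Intervals of \<open>X\<close> may be infinite, and \<^const>\<open>sum\<close> is \<open>0\<close> over infinite sets, so the
  convolution sum is restricted to its nonzero terms, which are finitely many
  (see \<open>finite_fi_mult_support\<close> below).
\<close>

definition fi_mult ::
  "'a rel \<Rightarrow> ('a \<Rightarrow> 'a \<Rightarrow> 'k::field) \<Rightarrow> ('a \<Rightarrow> 'a \<Rightarrow> 'k) \<Rightarrow> 'a \<Rightarrow> 'a \<Rightarrow> 'k" where
  "fi_mult r \<alpha> \<beta> = (\<lambda>x y. if (x, y) \<in> r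
     then \<Sum>z\<in>{z. (x, z) \<in> r \<and> (z, y) \<in> r \<and> \<alpha> x z * \<beta> z y \<noteq> 0}. \<alpha> x z * \<beta> z y
     else 0)"

definition e_set :: "'a set \<Rightarrow> 'a \<Rightarrow> 'a \<Rightarrow> 'k::field" where
  "e_set A = (\<lambda>x y. if x = y \<and> x \<in> A then 1 else 0)"

definition FI :: "'a set \<Rightarrow> 'a rel \<Rightarrow> ('k::field, 'a \<Rightarrow> 'a \<Rightarrow> 'k) module" where
  "FI X r =
    \<lparr>carrier = fi_carrier X r,
     mult = fi_mult r,
     one = e_set X,
     zero = (\<lambda>x y. 0),
     add = (\<lambda>\<alpha> \<beta> x y. \<alpha> x y + \<beta> x y),
     smult = (\<lambda>c \<alpha> x y. c * \<alpha> x y)\<rparr>"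

definition J_FI :: "'a set \<Rightarrow> 'a rel \<Rightarrow> ('a \<Rightarrow> 'a \<Rightarrow> 'k::field) set" where
  "J_FI X r = {\<alpha> \<in> carrier (FI X r). \<forall>x\<in>X. \<alpha> x x = 0}"

definition L1 :: "'a set \<Rightarrow> ('a \<Rightarrow> 'a \<Rightarrow> 'k::field) \<Rightarrow> 'a set" where
  "L1 X \<alpha> = {x \<in> X. \<alpha> x x = 1}"

text \<open>
  Linearity of a map on \<open>carrier M\<close>, the scalars being the whole type \<open>'k\<close>. The domain and
  codomain of the map are stated separately.
\<close>

definition linear_on :: "('k, 'b) module \<Rightarrow> ('b \<Rightarrow> 'b) \<Rightarrow> bool" where
  "linear_on M f \<longleftrightarrow>
    (\<forall>a\<in>carrier M. \<forall>b\<in>carrier M. f (a \<oplus>\<^bsub>M\<^esub> b) = f a \<oplus>\<^bsub>M\<^esub> f b) \<and>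
    (\<forall>c. \<forall>a\<in>carrier M. f (c \<odot>\<^bsub>M\<^esub> a) = c \<odot>\<^bsub>M\<^esub> f a)"

definition invertibility_preserver :: "('b, 'm) monoid_scheme \<Rightarrow> ('b \<Rightarrow> 'b) \<Rightarrow> bool" where
  "invertibility_preserver A f \<longleftrightarrow> f ` Units A \<subseteq> Units A"

definition unital :: "('b, 'm) monoid_scheme \<Rightarrow> ('b \<Rightarrow> 'b) \<Rightarrow> bool" where
  "unital A f \<longleftrightarrow> f \<one>\<^bsub>A\<^esub> = \<one>\<^bsub>A\<^esub>"

definition sym_diff_group :: "'a set \<Rightarrow> 'a set monoid" where
  "sym_diff_group X = \<lparr>carrier = Pow X, mult = (\<lambda>A B. sym_diff A B), one = {}\<rparr>"

lemma finite_fi_mult_support: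
  assumes po: "partial_order_on X r"
    and a: "\<alpha> \<in> carrier (FI X r)" and b: "\<beta> \<in> carrier (FI X r)" and xy: "(x, y) \<in> r"
  shows "finite {z. (x, z) \<in> r \<and> (z, y) \<in> r \<and> \<alpha> x z * \<beta> z y \<noteq> 0}" (is "finite ?S")
proof (cases "x = y")
  case True
  have "?S \<subseteq> {x}"
    using True partial_order_onD(3)[OF po] by (auto dest: antisymD)
  then show ?thesis
    by (rule finite_subset) simp
next
  case False
  let ?T = "{(u, v). (x, u) \<in> r \<and> (u, v) \<in> r \<and> u \<noteq> v \<and> (v, y) \<in> r \<and> \<alpha> u v \<noteq> 0}"
  have fin: "finite ?T"
    using a xy False by (simp add: FI_def fi_carrier_def)
  have xx: "(x, x) \<in> r"
    using partial_order_onD(1)[OF po] partial_order_onD(4)[OF po] xy by (auto simp: refl_on_def)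
  have "z \<in> insert x (snd ` ?T)" if z: "z \<in> ?S" for z
  proof (cases "z = x")
    case False
    then have "(x, z) \<in> ?T"
      using z xx by auto
    then show ?thesis
      by force
  qed simp
  then have "?S \<subseteq> insert x (snd ` ?T)"
    by blast
  then show ?thesis
    using fin by (meson finite_subset finite_insert finite_imageI)
qed

end

theory Submission
  imports Defs
begin

text \<open>
  An element is a unit exactly when its diagonal has no zero: a left inverse is computed by
  recursion on the finitely many nonzero off-diagonal coefficients in an interval, and since it
  has nonzero diagonal itself, it is a two-sided inverse. Hence over the field with two elements
  the units are \<open>\<delta> + J\<close>, so a unital linear invertibility preserver \<open>\<phi>\<close> maps \<open>J\<close> into \<open>J\<close>. As
  \<open>\<alpha> - e\<^bsub>L\<^sub>1(\<alpha>)\<^esub>\<close> lies in \<open>J\<close>, the diagonal of \<open>\<phi>(\<alpha>)\<close> depends only on \<open>L\<^sub>1(\<alpha>)\<close>, and one takes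
  \<open>\<lambda>(A) = L\<^sub>1(\<phi>(e\<^sub>A))\<close>.
\<close>

section \<open>Supports over an interval and the recursion for left inverses\<close>

text \<open>The set whose finiteness defines \<open>FI X r\<close>, as a function of the interval.
  Its cardinality is the measure for the recursion below and for the induction about it.\<close>

definition fi_support :: "'a rel \<Rightarrow> ('a \<Rightarrow> 'a \<Rightarrow> 'k::field) \<Rightarrow> 'a \<Rightarrow> 'a \<Rightarrow> ('a \<times> 'a) set" where
  "fi_support r \<alpha> x y =
    {(u, v). (x, u) \<in> r \<and> (u, v) \<in> r \<and> u \<noteq> v \<and> (v, y) \<in> r \<and> \<alpha> u v \<noteq> 0}"

text \<open>
  The equations \<open>\<Sum>z. \<beta> x z * \<alpha> z y = (if x = y then 1 else 0)\<close> solved for \<open>\<beta> x y\<close>. The condition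
  on cardinalities always holds in a poset (\<open>card_fi_support_less\<close>); it is there to ensure
  termination for arbitrary arguments.
\<close>

function fi_left_inv :: "'a rel \<Rightarrow> ('a \<Rightarrow> 'a \<Rightarrow> 'k::field) \<Rightarrow> 'a \<Rightarrow> 'a \<Rightarrow> 'k" where
  "fi_left_inv r \<alpha> x y =
    ((if x = y then 1 else 0) -
      (\<Sum>z\<in>{z. (x, z) \<in> r \<and> (z, y) \<in> r \<and> z \<noteq> y \<and> \<alpha> z y \<noteq> 0 \<and>
               card (fi_support r \<alpha> x z) < card (fi_support r \<alpha> x y)}.
        fi_left_inv r \<alpha> x z * \<alpha> z y)) / \<alpha> y y"
  by auto
termination
  by (relation "Wellfounded.measure (\<lambda>(r, \<alpha>, x, y). card (fi_support r \<alpha> x y))") auto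

declare fi_left_inv.simps [simp del]

lemma fi_carrier_iff:
  "\<alpha> \<in> carrier (FI X r) \<longleftrightarrow>
    (\<forall>x y. (x, y) \<notin> r \<longrightarrow> \<alpha> x y = 0) \<and>
    (\<forall>x y. (x, y) \<in> r \<and> x \<noteq> y \<longrightarrow> finite (fi_support r \<alpha> x y))"
  by (simp add: FI_def fi_carrier_def fi_support_def)

lemma FI_simps [simp]:
  "\<alpha> \<otimes>\<^bsub>FI X r\<^esub> \<beta> = fi_mult r \<alpha> \<beta>"
  "\<one>\<^bsub>FI X r\<^esub> = e_set X"
  "\<zero>\<^bsub>FI X r\<^esub> = (\<lambda>x y. 0)"
  "\<alpha> \<oplus>\<^bsub>FI X r\<^esub> \<beta> = (\<lambda>x y. \<alpha> x y + \<beta> x y)"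
  "c \<odot>\<^bsub>FI X r\<^esub> \<alpha> = (\<lambda>x y. c * \<alpha> x y)"
  by (simp_all add: FI_def)

lemma fi_vanishes: "\<alpha> \<in> carrier (FI X r) \<Longrightarrow> \<alpha> x y \<noteq> 0 \<Longrightarrow> (x, y) \<in> r"
  by (auto simp: fi_carrier_iff)

lemma fi_add_closed:
  assumes "\<alpha> \<in> carrier (FI X r)" "\<beta> \<in> carrier (FI X r)"
  shows "(\<lambda>x y. \<alpha> x y + \<beta> x y) \<in> carrier (FI X r)"
proof -
  have "finite (fi_support r (\<lambda>x y. \<alpha> x y + \<beta> x y) x y)" if "(x, y) \<in> r" "x \<noteq> y" for x y
  proof (rule finite_subset)
    show "fi_support r (\<lambda>x y. \<alpha> x y + \<beta> x y) x y \<subseteq> fi_support r \<alpha> x y \<union> fi_support r \<beta> x y"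
      by (auto simp: fi_support_def)
    show "finite (fi_support r \<alpha> x y \<union> fi_support r \<beta> x y)"
      using assms that by (simp add: fi_carrier_iff)
  qed
  then show ?thesis
    using assms by (simp add: fi_carrier_iff)
qed

text \<open>The default rewriting of \<open>+\<close> and \<open>*\<close> to bit operations would block the ring laws.\<close>

declare add_bit_eq_xor [simp del] mult_bit_eq_and [simp del]

section \<open>Characteristic two: addition, symmetric difference and linearity\<close>

lemma bit_add_self [simp]: "a + a = (0 :: bit)"
  by (cases a) simp_all

lemma bit_add_self_left [simp]: "a + (a + b) = (b :: bit)"
  by (simp flip: add.assoc)

lemma linear_on_FI_add:
  assumes "linear_on (FI X r) f" "\<alpha> \<in> carrier (FI X r)" "\<beta> \<in> carrier (FI X r)"
  shows "f (\<lambda>x y. \<alpha> x y + \<beta> x y) = (\<lambda>x y. f \<alpha> x y + f \<beta> x y)"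
  using assms by (simp add: linear_on_def)

text \<open>In the two-element field a sum is 1 iff exactly one summand is. With
  \<open>e_set_sym_diff\<close> and \<open>L1_e_set\<close> this makes \<open>L1\<close> a group
  homomorphism onto the subsets of \<open>X\<close> with section \<open>e_set\<close>.\<close>

lemma L1_add:
  fixes \<alpha> \<beta> :: "'a \<Rightarrow> 'a \<Rightarrow> bit"
  shows "L1 X (\<lambda>x y. \<alpha> x y + \<beta> x y) = sym_diff (L1 X \<alpha>) (L1 X \<beta>)"
proof -
  have "a + b = 1 \<longleftrightarrow> (a = 1) \<noteq> (b = 1)" for a b :: bit
    by (cases a; cases b) simp_all
  then show ?thesis
    by (auto simp: L1_def)
qed

lemma e_set_sym_diff:
  "(e_set (sym_diff A B) :: 'a \<Rightarrow> 'a \<Rightarrow> bit) = (\<lambda>x y. e_set A x y + e_set B x y)"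
  by (auto simp: e_set_def fun_eq_iff)

lemma L1_e_set: "A \<subseteq> X \<Longrightarrow> L1 X (e_set A) = A"
  by (auto simp: L1_def e_set_def)

text \<open>The only scalars are 0 and 1, so homogeneity reduces to \<open>f\<close> fixing the zero
  element, which follows from \<open>0 + 0 = 0\<close> because every element is its own
  negative.\<close>

lemma linear_on_FI_bit_iff:
  fixes f :: "('a \<Rightarrow> 'a \<Rightarrow> bit) \<Rightarrow> ('a \<Rightarrow> 'a \<Rightarrow> bit)"
  shows "linear_on (FI X r) f \<longleftrightarrow>
    (\<forall>\<alpha>\<in>carrier (FI X r). \<forall>\<beta>\<in>carrier (FI X r).
      f (\<lambda>x y. \<alpha> x y + \<beta> x y) = (\<lambda>x y. f \<alpha> x y + f \<beta> x y))"
proof -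
  have "f (\<lambda>x y. c * \<alpha> x y) = (\<lambda>x y. c * f \<alpha> x y)"
    if add: "\<forall>\<alpha>\<in>carrier (FI X r). \<forall>\<beta>\<in>carrier (FI X r).
        f (\<lambda>x y. \<alpha> x y + \<beta> x y) = (\<lambda>x y. f \<alpha> x y + f \<beta> x y)" for c \<alpha>
  proof -
    have "(\<lambda>x y. 0) \<in> carrier (FI X r :: (bit, _) module)"
      by (simp add: fi_carrier_iff fi_support_def)
    from add[rule_format, OF this this] have "f (\<lambda>x y. 0) = (\<lambda>x y. 0)"
      by simp
    then show ?thesis
      by (cases c) simp_all
  qed
  then show ?thesis
    by (auto simp: linear_on_def)
qed

section \<open>Multiplication over a fixed poset: associativity, identity, diagonal\<close>

context
  fixes X :: "'a set" and r :: "'a rel"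
  assumes po: "partial_order_on X r"
begin

lemma po_refl: "x \<in> X \<Longrightarrow> (x, x) \<in> r"
  using partial_order_onD(1)[OF po] by (auto dest: refl_onD)

lemma po_trans: "(x, y) \<in> r \<Longrightarrow> (y, z) \<in> r \<Longrightarrow> (x, z) \<in> r"
  using partial_order_onD(2)[OF po] by (rule transD)

lemma po_antisym: "(x, y) \<in> r \<Longrightarrow> (y, x) \<in> r \<Longrightarrow> x = y"
  using partial_order_onD(3)[OF po] by (rule antisymD)

lemma po_in_carrier: "(x, y) \<in> r \<Longrightarrow> x \<in> X" "(x, y) \<in> r \<Longrightarrow> y \<in> X"
  using partial_order_onD(4)[OF po] by auto

text \<open>The carrier only constrains \<open>x < y\<close>. For all other pairs the set is empty:
  by antisymmetry if \<open>x = y\<close>, by transitivity if \<open>x \<le> y\<close>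
  fails.\<close>

lemma finite_fi_support:
  assumes "\<alpha> \<in> carrier (FI X r)"
  shows "finite (fi_support r \<alpha> x y)"
proof (cases "(x, y) \<in> r \<and> x \<noteq> y")
  case True
  then show ?thesis
    using assms by (auto simp: fi_carrier_iff)
next
  case False
  then have "fi_support r \<alpha> x y = {}"
    by (auto simp: fi_support_def dest: po_antisym po_trans)
  then show ?thesis
    by simp
qed

text \<open>The index set in \<open>fi_mult\<close> varies with the factors. Any finite superset
  gives the same sum, so several convolutions can share one index set; if \<open>x \<le> y\<close>
  fails, transitivity kills every term.\<close>

lemma fi_mult_eq_sum:
  assumes a: "\<alpha> \<in> carrier (FI X r)" and b: "\<beta> \<in> carrier (FI X r)"
    and "finite Z" and Z: "\<And>z. \<alpha> x z \<noteq> 0 \<Longrightarrow> \<beta> z y \<noteq> 0 \<Longrightarrow> z \<in> Z"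
  shows "fi_mult r \<alpha> \<beta> x y = (\<Sum>z\<in>Z. \<alpha> x z * \<beta> z y)"
proof (cases "(x, y) \<in> r")
  case True
  then show ?thesis
    unfolding fi_mult_def using \<open>finite Z\<close> Z fi_vanishes[OF a] fi_vanishes[OF b]
    by (auto intro!: sum.mono_neutral_left)
next
  case False
  then have "\<alpha> x z * \<beta> z y = 0" for z
    using fi_vanishes[OF a, of x z] fi_vanishes[OF b, of z y] po_trans by auto
  then show ?thesis
    using False by (simp add: fi_mult_def del: mult_eq_0_iff)
qed

text \<open>All convolutions at \<open>(x, y)\<close> run over one finite set, so the double sum can
  be interchanged. Closure under products enters as the assumptions \<open>ab\<close> and
  \<open>bc\<close>; in the application both products are the identity.\<close>

lemma fi_mult_assoc:
  assumes a: "\<alpha> \<in> carrier (FI X r)" and b: "\<beta> \<in> carrier (FI X r)" and c: "\<gamma> \<in> carrier (FI X r)"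
    and ab: "fi_mult r \<alpha> \<beta> \<in> carrier (FI X r)" and bc: "fi_mult r \<beta> \<gamma> \<in> carrier (FI X r)"
  shows "fi_mult r (fi_mult r \<alpha> \<beta>) \<gamma> = fi_mult r \<alpha> (fi_mult r \<beta> \<gamma>)"
proof (intro ext)
  fix x y
  show "fi_mult r (fi_mult r \<alpha> \<beta>) \<gamma> x y = fi_mult r \<alpha> (fi_mult r \<beta> \<gamma>) x y"
  proof (cases "(x, y) \<in> r")
    case True
    \<comment> \<open>The outer factors determine the relevant points: second components for
      \<alpha> catch \<open>z\<close> with \<open>\<alpha> x z \<noteq> 0\<close>, first components
      for \<gamma> catch \<open>w\<close> with \<open>\<gamma> w y \<noteq> 0\<close>, and
      \<open>x\<close>, \<open>y\<close> account for diagonal coefficients.\<close>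
    define Z where "Z = {x, y} \<union> snd ` fi_support r \<alpha> x y \<union> fst ` fi_support r \<gamma> x y"
    have fin: "finite Z"
      by (simp add: Z_def finite_fi_support a c)
    have refl: "(x, x) \<in> r" "(y, y) \<in> r"
      using True po_in_carrier po_refl by blast+
    have Z1: "z \<in> Z" if "\<alpha> x z \<noteq> 0" "(z, y) \<in> r" for z
    proof (cases "z = x")
      case False
      then have "(x, z) \<in> fi_support r \<alpha> x y"
        using that refl fi_vanishes[OF a] by (auto simp: fi_support_def)
      then show ?thesis
        by (force simp: Z_def)
    qed (simp add: Z_def)
    have Z2: "w \<in> Z" if "\<gamma> w y \<noteq> 0" "(x, w) \<in> r" for w
    proof (cases "w = y")
      case False
      then have "(w, y) \<in> fi_support r \<gamma> x y"
        using that refl fi_vanishes[OF c] by (auto simp: fi_support_def)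
      then show ?thesis
        by (force simp: Z_def)
    qed (simp add: Z_def)
    \<comment> \<open>\<open>Z\<close> is built for \<open>(x, y)\<close>, not for
      \<open>(x, w)\<close>. It serves the inner sum only if \<open>w \<le> y\<close>, which a
      nonzero \<open>\<gamma> w y\<close> guarantees; otherwise both sides are 0. \<open>R\<close>
      is the mirror image.\<close>
    have L: "fi_mult r \<alpha> \<beta> x w * \<gamma> w y = (\<Sum>z\<in>Z. \<alpha> x z * \<beta> z w) * \<gamma> w y" for w
    proof (cases "\<gamma> w y = 0")
      case False
      then have "fi_mult r \<alpha> \<beta> x w = (\<Sum>z\<in>Z. \<alpha> x z * \<beta> z w)"
        using Z1 fi_vanishes[OF b] fi_vanishes[OF c] po_trans
        by (intro fi_mult_eq_sum[OF a b fin]) blast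
      then show ?thesis
        by simp
    qed simp
    have R: "\<alpha> x z * fi_mult r \<beta> \<gamma> z y = \<alpha> x z * (\<Sum>w\<in>Z. \<beta> z w * \<gamma> w y)" for z
    proof (cases "\<alpha> x z = 0")
      case False
      then have "fi_mult r \<beta> \<gamma> z y = (\<Sum>w\<in>Z. \<beta> z w * \<gamma> w y)"
        using Z2 fi_vanishes[OF b] fi_vanishes[OF a] po_trans
        by (intro fi_mult_eq_sum[OF b c fin]) blast
      then show ?thesis
        by simp
    qed simp
    have "fi_mult r (fi_mult r \<alpha> \<beta>) \<gamma> x y = (\<Sum>w\<in>Z. fi_mult r \<alpha> \<beta> x w * \<gamma> w y)"
      using Z2 fi_vanishes[OF ab] by (intro fi_mult_eq_sum[OF ab c fin]) blast
    also have "\<dots> = (\<Sum>w\<in>Z. \<Sum>z\<in>Z. \<alpha> x z * \<beta> z w * \<gamma> w y)"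
      by (simp add: L sum_distrib_right)
    also have "\<dots> = (\<Sum>z\<in>Z. \<Sum>w\<in>Z. \<alpha> x z * \<beta> z w * \<gamma> w y)"
      by (rule sum.swap)
    also have "\<dots> = (\<Sum>z\<in>Z. \<alpha> x z * fi_mult r \<beta> \<gamma> z y)"
      by (simp add: R sum_distrib_left mult.assoc)
    also have "\<dots> = fi_mult r \<alpha> (fi_mult r \<beta> \<gamma>) x y"
      using Z1 fi_vanishes[OF bc] by (intro fi_mult_eq_sum[OF a bc fin, symmetric]) blast
    finally show ?thesis .
  qed (simp add: fi_mult_def)
qed

lemma e_set_closed:
  assumes "A \<subseteq> X"
  shows "e_set A \<in> carrier (FI X r)"
proof -
  have "fi_support r (e_set A :: 'a \<Rightarrow> 'a \<Rightarrow> 'b) x y = {}" for x y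
    by (auto simp: fi_support_def e_set_def)
  then show ?thesis
    using assms po_refl by (auto simp: fi_carrier_iff e_set_def)
qed

lemma fi_mult_one_left:
  assumes "\<alpha> \<in> carrier (FI X r)"
  shows "fi_mult r (e_set X) \<alpha> = \<alpha>"
proof (intro ext)
  fix x y
  have "fi_mult r (e_set X) \<alpha> x y = (\<Sum>z\<in>{x}. e_set X x z * \<alpha> z y)"
    using assms by (intro fi_mult_eq_sum e_set_closed) (auto simp: e_set_def split: if_splits)
  then show "fi_mult r (e_set X) \<alpha> x y = \<alpha> x y"
    using fi_vanishes[OF assms, of x y] po_in_carrier by (auto simp: e_set_def)
qed

lemma fi_mult_one_right:
  assumes "\<alpha> \<in> carrier (FI X r)"
  shows "fi_mult r \<alpha> (e_set X) = \<alpha>"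
proof (intro ext)
  fix x y
  have "fi_mult r \<alpha> (e_set X) x y = (\<Sum>z\<in>{y}. \<alpha> x z * e_set X z y)"
    using assms by (intro fi_mult_eq_sum e_set_closed) (auto simp: e_set_def split: if_splits)
  then show "fi_mult r \<alpha> (e_set X) x y = \<alpha> x y"
    using fi_vanishes[OF assms, of x y] po_in_carrier by (auto simp: e_set_def)
qed

text \<open>By antisymmetry the convolution at \<open>(x, x)\<close> has the single index
  \<open>x\<close>.\<close>

lemma fi_mult_diag:
  assumes "\<alpha> \<in> carrier (FI X r)" "\<beta> \<in> carrier (FI X r)"
  shows "fi_mult r \<alpha> \<beta> x x = \<alpha> x x * \<beta> x x"
proof -
  have "fi_mult r \<alpha> \<beta> x x = (\<Sum>z\<in>{x}. \<alpha> x z * \<beta> z x)"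
    using assms by (intro fi_mult_eq_sum) (auto dest: fi_vanishes po_antisym)
  then show ?thesis
    by simp
qed

section \<open>The recursively defined left inverse\<close>

lemma fi_support_mono:
  assumes "(x', x) \<in> r" "(y, y') \<in> r"
  shows "fi_support r \<alpha> x y \<subseteq> fi_support r \<alpha> x' y'"
  using assms by (auto simp: fi_support_def intro: po_trans)

text \<open>The pair \<open>(z, y)\<close> is counted for the interval from \<open>x\<close> to
  \<open>y\<close> but not for that from \<open>x\<close> to \<open>z\<close>, since
  \<open>y \<le> z\<close> would force \<open>z = y\<close>. This makes the guard in
  \<open>fi_left_inv\<close> automatic.\<close>

lemma card_fi_support_less:
  assumes a: "\<alpha> \<in> carrier (FI X r)" and "(x, z) \<in> r" "(z, y) \<in> r" "z \<noteq> y" "\<alpha> z y \<noteq> 0"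
  shows "card (fi_support r \<alpha> x z) < card (fi_support r \<alpha> x y)"
proof (rule psubset_card_mono)
  have "(z, y) \<in> fi_support r \<alpha> x y - fi_support r \<alpha> x z"
    using assms po_in_carrier po_refl by (auto simp: fi_support_def dest: po_antisym)
  then show "fi_support r \<alpha> x z \<subset> fi_support r \<alpha> x y"
    using fi_support_mono[of x x z y \<alpha>] assms po_in_carrier po_refl by blast
qed (rule finite_fi_support[OF a])

lemma fi_left_inv_eq:
  assumes a: "\<alpha> \<in> carrier (FI X r)"
  shows "fi_left_inv r \<alpha> x y =
    ((if x = y then 1 else 0) -
      (\<Sum>z\<in>{z. (x, z) \<in> r \<and> (z, y) \<in> r \<and> z \<noteq> y \<and> \<alpha> z y \<noteq> 0}. fi_left_inv r \<alpha> x z * \<alpha> z y)) / \<alpha> y y"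
proof -
  have "{z. (x, z) \<in> r \<and> (z, y) \<in> r \<and> z \<noteq> y \<and> \<alpha> z y \<noteq> 0 \<and>
            card (fi_support r \<alpha> x z) < card (fi_support r \<alpha> x y)}
      = {z. (x, z) \<in> r \<and> (z, y) \<in> r \<and> z \<noteq> y \<and> \<alpha> z y \<noteq> 0}"
    using card_fi_support_less[OF a] by blast
  then show ?thesis
    by (subst fi_left_inv.simps) simp
qed

lemma fi_left_inv_diag:
  assumes a: "\<alpha> \<in> carrier (FI X r)"
  shows "fi_left_inv r \<alpha> x x = inverse (\<alpha> x x)"
proof -
  have empty: "{z. (x, z) \<in> r \<and> (z, x) \<in> r \<and> z \<noteq> x \<and> \<alpha> z x \<noteq> 0} = {}"
    using po_antisym by blast
  show ?thesis
    using fi_left_inv_eq[OF a, of x x] unfolding empty by (simp add: inverse_eq_divide)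
qed

text \<open>Unfolding the recursion, a nonzero off-diagonal coefficient of the inverse needs a chain
  from \<open>x\<close> to \<open>y\<close> of nonzero coefficients of \<alpha>. Its first pair
  starts at \<open>x\<close> and its last ends at \<open>y\<close>. The last pair is
  \<open>(z, y)\<close> below; the first comes from the induction hypothesis unless
  \<open>z = x\<close>.\<close>

lemma fi_left_inv_support:
  assumes a: "\<alpha> \<in> carrier (FI X r)"
  shows "fi_left_inv r \<alpha> x y \<noteq> 0 \<Longrightarrow> x \<noteq> y \<Longrightarrow>
    (x, y) \<in> r \<and> x \<in> fst ` fi_support r \<alpha> x y \<and> y \<in> snd ` fi_support r \<alpha> x y"
proof (induction "card (fi_support r \<alpha> x y)" arbitrary: y rule: less_induct)
  case less
  have "(\<Sum>z\<in>{z. (x, z) \<in> r \<and> (z, y) \<in> r \<and> z \<noteq> y \<and> \<alpha> z y \<noteq> 0}.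
      fi_left_inv r \<alpha> x z * \<alpha> z y) \<noteq> 0"
    using less.prems fi_left_inv_eq[OF a, of x y] by fastforce
  then obtain z where z: "(x, z) \<in> r" "(z, y) \<in> r" "z \<noteq> y" "\<alpha> z y \<noteq> 0" "fi_left_inv r \<alpha> x z \<noteq> 0"
    by (rule sum.not_neutral_contains_not_neutral) auto
  have xy: "(x, y) \<in> r"
    using z po_trans by blast
  have zy: "(z, y) \<in> fi_support r \<alpha> x y"
    using z po_in_carrier po_refl by (auto simp: fi_support_def)
  have "x \<in> fst ` fi_support r \<alpha> x y"
  proof (cases "x = z")
    case True
    then show ?thesis
      using zy by force
  next
    case False
    then have "x \<in> fst ` fi_support r \<alpha> x z"
      using less.hyps[OF card_fi_support_less[OF a z(1-4)] z(5)] by blast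
    then show ?thesis
      using fi_support_mono[of x x z y \<alpha>] z po_in_carrier po_refl by blast
  qed
  then show ?case
    using xy zy by force
qed

lemma fi_left_inv_closed:
  assumes a: "\<alpha> \<in> carrier (FI X r)"
  shows "fi_left_inv r \<alpha> \<in> carrier (FI X r)"
  unfolding fi_carrier_iff
proof (intro conjI allI impI)
  fix x y
  assume "(x, y) \<notin> r"
  then show "fi_left_inv r \<alpha> x y = 0"
    \<comment> \<open>If \<open>x = y\<close> lies outside the poset then
      \<open>\<alpha> x x = 0\<close>, and the convention \<open>inverse 0 = 0\<close> gives the
      required value.\<close>
    using fi_left_inv_support[OF a, of x y] fi_left_inv_diag[OF a, of x] fi_vanishes[OF a, of x y]
    by (cases "x = y") auto
next
  fix x y
  \<comment> \<open>Both ends of a nonzero coefficient of the inverse are ends of nonzero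
    coefficients of \<alpha> in the same interval, so they range over a product of two finite
    sets.\<close>
  have "fi_support r (fi_left_inv r \<alpha>) x y \<subseteq>
      fst ` fi_support r \<alpha> x y \<times> snd ` fi_support r \<alpha> x y"
  proof
    fix p
    assume "p \<in> fi_support r (fi_left_inv r \<alpha>) x y"
    then obtain u v where p: "p = (u, v)" "(x, u) \<in> r" "(v, y) \<in> r" "u \<noteq> v" "fi_left_inv r \<alpha> u v \<noteq> 0"
      by (auto simp: fi_support_def)
    then show "p \<in> fst ` fi_support r \<alpha> x y \<times> snd ` fi_support r \<alpha> x y"
      using fi_left_inv_support[OF a p(5,4)] fi_support_mono[OF p(2,3), of \<alpha>] by blast
  qed
  then show "finite (fi_support r (fi_left_inv r \<alpha>) x y)"
    by (rule finite_subset) (simp add: finite_fi_support[OF a])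
qed

text \<open>The recursion is the convolution equation solved for its term at \<open>z = y\<close>.
  Splitting off that term reverses the step; the nonzero diagonal allows cancelling
  \<open>\<alpha> y y\<close>.\<close>

lemma fi_left_inv_mult:
  assumes a: "\<alpha> \<in> carrier (FI X r)" and diag: "\<forall>x\<in>X. \<alpha> x x \<noteq> 0"
  shows "fi_mult r (fi_left_inv r \<alpha>) \<alpha> = e_set X"
proof (intro ext)
  fix x y
  let ?b = "fi_left_inv r \<alpha>"
  let ?S = "{z. (x, z) \<in> r \<and> (z, y) \<in> r \<and> z \<noteq> y \<and> \<alpha> z y \<noteq> 0}"
  show "fi_mult r ?b \<alpha> x y = e_set X x y"
  proof (cases "(x, y) \<in> r")
    case True
    then have y: "y \<in> X" "(y, y) \<in> r"
      using po_in_carrier po_refl by blast+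
    have "?S \<subseteq> fst ` fi_support r \<alpha> x y"
      using y by (force simp: fi_support_def)
    then have fin: "finite ?S"
      by (rule finite_subset) (simp add: finite_fi_support[OF a])
    have "fi_mult r ?b \<alpha> x y = (\<Sum>z\<in>insert y ?S. ?b x z * \<alpha> z y)"
      using fin fi_vanishes[OF a] fi_vanishes[OF fi_left_inv_closed[OF a]]
      by (intro fi_mult_eq_sum fi_left_inv_closed a) auto
    also have "\<dots> = ?b x y * \<alpha> y y + (\<Sum>z\<in>?S. ?b x z * \<alpha> z y)"
      using fin by simp
    also have "\<dots> = (if x = y then 1 else 0)"
      using diag y by (subst fi_left_inv_eq[OF a]) simp
    finally show ?thesis
      using True po_in_carrier by (simp add: e_set_def)
  next
    case False
    then show ?thesis
      using po_refl by (auto simp: fi_mult_def e_set_def)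
  qed
qed

section \<open>Units, and the action of preservers on the radical\<close>

lemma Units_FI:
  "Units (FI X r) = {\<alpha> \<in> carrier (FI X r). \<forall>x\<in>X. \<alpha> x x \<noteq> (0 :: 'k::field)}" (is "_ = ?D")
proof (intro equalityI subsetI)
  fix \<alpha> :: "'a \<Rightarrow> 'a \<Rightarrow> 'k"
  assume "\<alpha> \<in> Units (FI X r)"
  then obtain \<beta> where a: "\<alpha> \<in> carrier (FI X r)" and b: "\<beta> \<in> carrier (FI X r)"
    and ba: "fi_mult r \<beta> \<alpha> = e_set X"
    by (auto simp: Units_def)
  have "\<beta> x x * \<alpha> x x = 1" if "x \<in> X" for x
    using fi_mult_diag[OF b a, of x] that by (simp add: ba e_set_def)
  then show "\<alpha> \<in> ?D"
    using a by force
next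
  fix \<alpha> :: "'a \<Rightarrow> 'a \<Rightarrow> 'k"
  assume "\<alpha> \<in> ?D"
  then have a: "\<alpha> \<in> carrier (FI X r)" and diag: "\<forall>x\<in>X. \<alpha> x x \<noteq> 0"
    by auto
  define \<beta> where "\<beta> = fi_left_inv r \<alpha>"
  \<comment> \<open>A left inverse \<gamma> of the left inverse \<beta> must equal \<alpha> by
    associativity, so its equation with \<beta> says that \<beta> is also a right inverse of
    \<alpha>.\<close>
  define \<gamma> where "\<gamma> = fi_left_inv r \<beta>"
  have b: "\<beta> \<in> carrier (FI X r)" and ba: "fi_mult r \<beta> \<alpha> = e_set X"
    unfolding \<beta>_def using fi_left_inv_closed[OF a] fi_left_inv_mult[OF a diag] by auto
  have "\<forall>x\<in>X. \<beta> x x \<noteq> 0"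
    using diag by (simp add: \<beta>_def fi_left_inv_diag[OF a])
  then have c: "\<gamma> \<in> carrier (FI X r)" and cb: "fi_mult r \<gamma> \<beta> = e_set X"
    unfolding \<gamma>_def using fi_left_inv_closed[OF b] fi_left_inv_mult[OF b] by auto
  have "\<gamma> = fi_mult r \<gamma> (fi_mult r \<beta> \<alpha>)"
    by (simp add: ba fi_mult_one_right[OF c])
  also have "\<dots> = fi_mult r (fi_mult r \<gamma> \<beta>) \<alpha>"
    using fi_mult_assoc[OF c b a] by (simp add: cb ba e_set_closed)
  also have "\<dots> = \<alpha>"
    by (simp add: cb fi_mult_one_left[OF a])
  finally have "fi_mult r \<alpha> \<beta> = e_set X"
    using cb by simp
  then show "\<alpha> \<in> Units (FI X r)"
    using a b ba by (auto simp: Units_def)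
qed

text \<open>\<open>\<delta> + j\<close> is a unit, hence so is its image
  \<open>\<delta> + \<phi> j\<close>. A diagonal entry 1 of \<open>\<phi> j\<close> would give
  \<open>1 + 1 = 0\<close> on the diagonal of that unit.\<close>

lemma preserver_J_FI:
  fixes \<phi> :: "('a \<Rightarrow> 'a \<Rightarrow> bit) \<Rightarrow> ('a \<Rightarrow> 'a \<Rightarrow> bit)"
  assumes maps: "\<phi> \<in> carrier (FI X r) \<rightarrow> carrier (FI X r)"
    and un: "unital (FI X r) \<phi>" and lin: "linear_on (FI X r) \<phi>"
    and inv: "invertibility_preserver (FI X r) \<phi>" and j: "j \<in> J_FI X r"
  shows "\<phi> j \<in> J_FI X r"
proof -
  have jc: "j \<in> carrier (FI X r)" and jd: "\<forall>x\<in>X. j x x = 0"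
    using j by (auto simp: J_FI_def)
  have "(\<lambda>x y. e_set X x y + j x y) \<in> Units (FI X r)"
    using fi_add_closed[OF e_set_closed[of X] jc] jd by (auto simp: Units_FI e_set_def)
  then have "\<phi> (\<lambda>x y. e_set X x y + j x y) \<in> Units (FI X r)"
    using inv by (auto simp: invertibility_preserver_def)
  moreover have "\<phi> (\<lambda>x y. e_set X x y + j x y) = (\<lambda>x y. e_set X x y + \<phi> j x y)"
    using linear_on_FI_add[OF lin e_set_closed[of X] jc] un by (simp add: unital_def)
  ultimately have unit: "(\<lambda>x y. e_set X x y + \<phi> j x y) \<in> Units (FI X r)"
    by simp
  have "\<phi> j x x = 0" if "x \<in> X" for x
  proof (rule ccontr)
    assume "\<phi> j x x \<noteq> 0"
    then have "e_set X x x + \<phi> j x x = 0"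
      using that by (simp add: e_set_def)
    then show False
      using unit that unfolding Units_FI by blast
  qed
  then show ?thesis
    using maps jc by (auto simp: J_FI_def)
qed

end

section \<open>Passing between preservers and pairs \<open>(lam, \<psi>)\<close>\<close>

theorem theorem2p30:
  fixes X :: "'a set" and r :: "'a rel"
    and \<phi> :: "('a \<Rightarrow> 'a \<Rightarrow> bit) \<Rightarrow> ('a \<Rightarrow> 'a \<Rightarrow> bit)"
  assumes "partial_order_on X r"
    and "\<phi> \<in> carrier (FI X r) \<rightarrow> carrier (FI X r)"
  shows "(unital (FI X r) \<phi> \<and> linear_on (FI X r) \<phi> \<and> invertibility_preserver (FI X r) \<phi>)
    \<longleftrightarrow>
    (\<exists>lam \<psi>. lam \<in> hom (sym_diff_group X) (sym_diff_group X) \<and> lam X = X \<and>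
       \<psi> \<in> carrier (FI X r) \<rightarrow> J_FI X r \<and> linear_on (FI X r) \<psi> \<and>
       \<psi> \<one>\<^bsub>FI X r\<^esub> = \<zero>\<^bsub>FI X r\<^esub> \<and>
       (\<forall>\<alpha>\<in>carrier (FI X r). \<phi> \<alpha> = e_set (lam (L1 X \<alpha>)) \<oplus>\<^bsub>FI X r\<^esub> \<psi> \<alpha>))"
proof
  assume L: "unital (FI X r) \<phi> \<and> linear_on (FI X r) \<phi> \<and> invertibility_preserver (FI X r) \<phi>"
  note po = assms(1) and e_closed = e_set_closed[OF assms(1)]
  have add: "\<phi> (\<lambda>x y. \<alpha> x y + \<beta> x y) = (\<lambda>x y. \<phi> \<alpha> x y + \<phi> \<beta> x y)"
    if "\<alpha> \<in> carrier (FI X r)" "\<beta> \<in> carrier (FI X r)" for \<alpha> \<beta>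
    using L that by (intro linear_on_FI_add) auto
  have one: "\<phi> (e_set X) = e_set X"
    using L by (simp add: unital_def)
  define lam where "lam A = L1 X (\<phi> (e_set A))" for A
  \<comment> \<open>In characteristic two the sum is also the difference of \<phi> and its
    prescribed diagonal part.\<close>
  define \<psi> where "\<psi> \<alpha> = (\<lambda>x y. \<phi> \<alpha> x y + e_set (lam (L1 X \<alpha>)) x y)" for \<alpha>
  have L1_sub: "L1 X \<alpha> \<subseteq> X" for \<alpha> :: "'a \<Rightarrow> 'a \<Rightarrow> bit"
    by (auto simp: L1_def)
  have lam_sub: "lam A \<subseteq> X" for A
    by (simp add: lam_def L1_sub)
  \<comment> \<open>\<open>lam\<close> is the composite of the additive maps \<open>e_set\<close>,
    \<phi> and \<open>L1\<close>.\<close>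
  have lam_add: "lam (sym_diff A B) = sym_diff (lam A) (lam B)" if "A \<subseteq> X" "B \<subseteq> X" for A B
    by (simp add: lam_def e_set_sym_diff add e_closed that L1_add)
  have lam_X: "lam X = X"
    by (simp add: lam_def one L1_e_set)
  have \<psi>_J: "\<psi> \<alpha> \<in> J_FI X r" if a: "\<alpha> \<in> carrier (FI X r)" for \<alpha>
  proof -
    have e: "e_set (L1 X \<alpha>) \<in> carrier (FI X r)"
      by (simp add: e_closed L1_sub)
    \<comment> \<open>The two summands have the same diagonal, which cancels. Applying \<phi> shows
      that \<open>\<phi> \<alpha>\<close> and \<open>\<phi> (e_set (L1 X \<alpha>))\<close> agree on
      the diagonal, and the ones of the latter form \<open>lam (L1 X \<alpha>)\<close>.\<close>
    have "(\<lambda>x y. \<alpha> x y + e_set (L1 X \<alpha>) x y) \<in> J_FI X r"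
      using fi_add_closed[OF a e] by (auto simp: J_FI_def e_set_def L1_def)
    then have "\<phi> (\<lambda>x y. \<alpha> x y + e_set (L1 X \<alpha>) x y) \<in> J_FI X r"
      using preserver_J_FI[OF po assms(2)] L by blast
    then have "\<forall>x\<in>X. \<phi> \<alpha> x x + \<phi> (e_set (L1 X \<alpha>)) x x = 0"
      by (simp add: J_FI_def add[OF a e])
    then have "\<forall>x\<in>X. \<psi> \<alpha> x x = 0"
      by (auto simp: \<psi>_def lam_def e_set_def L1_def)
    moreover have "\<psi> \<alpha> \<in> carrier (FI X r)"
      unfolding \<psi>_def using assms(2) a by (intro fi_add_closed e_closed lam_sub) auto
    ultimately show ?thesis
      by (simp add: J_FI_def)
  qed
  have "lam \<in> hom (sym_diff_group X) (sym_diff_group X)"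
    using lam_sub lam_add by (auto simp: hom_def sym_diff_group_def)
  moreover have "linear_on (FI X r) \<psi>"
    by (simp add: linear_on_FI_bit_iff \<psi>_def add L1_add lam_add L1_sub e_set_sym_diff
        add.assoc add.left_commute fun_eq_iff)
  moreover have "\<psi> (e_set X) = (\<lambda>x y. 0)"
    by (simp add: \<psi>_def one L1_e_set lam_X)
  moreover have "\<phi> \<alpha> = (\<lambda>x y. e_set (lam (L1 X \<alpha>)) x y + \<psi> \<alpha> x y)" for \<alpha>
    by (simp add: \<psi>_def add.left_commute)
  ultimately show "\<exists>lam \<psi>. lam \<in> hom (sym_diff_group X) (sym_diff_group X) \<and> lam X = X \<and>
       \<psi> \<in> carrier (FI X r) \<rightarrow> J_FI X r \<and> linear_on (FI X r) \<psi> \<and>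
       \<psi> \<one>\<^bsub>FI X r\<^esub> = \<zero>\<^bsub>FI X r\<^esub> \<and>
       (\<forall>\<alpha>\<in>carrier (FI X r). \<phi> \<alpha> = e_set (lam (L1 X \<alpha>)) \<oplus>\<^bsub>FI X r\<^esub> \<psi> \<alpha>)"
    using lam_X \<psi>_J unfolding FI_simps by blast
next
  assume "\<exists>lam \<psi>. lam \<in> hom (sym_diff_group X) (sym_diff_group X) \<and> lam X = X \<and>
       \<psi> \<in> carrier (FI X r) \<rightarrow> J_FI X r \<and> linear_on (FI X r) \<psi> \<and>
       \<psi> \<one>\<^bsub>FI X r\<^esub> = \<zero>\<^bsub>FI X r\<^esub> \<and>
       (\<forall>\<alpha>\<in>carrier (FI X r). \<phi> \<alpha> = e_set (lam (L1 X \<alpha>)) \<oplus>\<^bsub>FI X r\<^esub> \<psi> \<alpha>)"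
  then obtain lam \<psi> where hom: "lam \<in> hom (sym_diff_group X) (sym_diff_group X)"
    and lam_X: "lam X = X" and \<psi>_J: "\<psi> \<in> carrier (FI X r) \<rightarrow> J_FI X r"
    and \<psi>_lin: "linear_on (FI X r) \<psi>" and \<psi>_one: "\<psi> (e_set X) = (\<lambda>x y. 0)"
    and \<phi>: "\<And>\<alpha>. \<alpha> \<in> carrier (FI X r) \<Longrightarrow> \<phi> \<alpha> = (\<lambda>x y. e_set (lam (L1 X \<alpha>)) x y + \<psi> \<alpha> x y)"
    unfolding FI_simps by blast
  note po = assms(1)
  have lam_add: "lam (sym_diff A B) = sym_diff (lam A) (lam B)" if "A \<subseteq> X" "B \<subseteq> X" for A B
    using hom that by (auto simp: hom_def sym_diff_group_def)
  have L1_sub: "L1 X \<alpha> \<subseteq> X" for \<alpha> :: "'a \<Rightarrow> 'a \<Rightarrow> bit"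
    by (auto simp: L1_def)
  \<comment> \<open>At the identity \<open>L1\<close> is \<open>X\<close>, which \<open>lam\<close>
    fixes, and \<psi> contributes nothing.\<close>
  have "unital (FI X r) \<phi>"
    by (simp add: unital_def \<phi> e_set_closed[OF po] L1_e_set lam_X \<psi>_one)
  moreover have "linear_on (FI X r) \<phi>"
    using \<psi>_lin by (simp add: linear_on_FI_bit_iff \<phi> fi_add_closed L1_add lam_add L1_sub
        e_set_sym_diff add.assoc add.left_commute fun_eq_iff)
  moreover have "invertibility_preserver (FI X r) \<phi>"
    unfolding invertibility_preserver_def
  proof (intro image_subsetI)
    fix \<alpha> :: "'a \<Rightarrow> 'a \<Rightarrow> bit"
    assume "\<alpha> \<in> Units (FI X r)"
    then have a: "\<alpha> \<in> carrier (FI X r)" and "\<forall>x\<in>X. \<alpha> x x \<noteq> 0"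
      by (auto simp: Units_FI[OF po])
    then have "L1 X \<alpha> = X"
      by (auto simp: L1_def)
    \<comment> \<open>Nonzero means 1 here, so a unit has \<open>L1 X \<alpha> = X\<close>; then
      \<open>e_set (lam X)\<close> supplies a diagonal of ones, and \<psi> adds 0 to it.\<close>
    then have "\<phi> \<alpha> x x = 1" if "x \<in> X" for x
      using that \<psi>_J a by (auto simp: \<phi> lam_X e_set_def J_FI_def)
    then show "\<phi> \<alpha> \<in> Units (FI X r)"
      using assms(2) a by (auto simp: Units_FI[OF po])
  qed
  ultimately show "unital (FI X r) \<phi> \<and> linear_on (FI X r) \<phi> \<and> invertibility_preserver (FI X r) \<phi>"
    by blast
qed

end
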